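(* Let $(\mathcal A^*,d)$ be an $(r-1)$-connected Poincar\'e DGCA over $\mathbb Q$ of degree $n\le5r-2$, where $r\ge2$, and suppose that $\mathcal A^*$ admits a Hodge homotopy $d^-$ and that $b^r=\dim H^r(\mathcal A)\le2$. Then the operations of the minimal unital cyclic $C_\infty$-algebra transferred to $H^*(\mathcal A)$ via $d^-$ satisfy $$m_k=0\qquad\text{for every }k\ge4.$$
   Context: A Poincar\'e DGCA (PDGCA) of degree $n$ over a field $\mathbb F$ of characteristic zero is a unital differential graded commutative algebra $\mathcal A^*=\bigoplus_{k=0}^n\mathcal A^k$ with finite-dimensional cohomology $H^*(\mathcal A)$ and a linear functional $\int\colon H^n(\mathcal A)\to\mathbb F$ such that $\langle\alpha,\beta\rangle=\int\alpha\cdot\beta$ if $|\alpha|+|\beta|=n$, and $0$ otherwise, is nondegenerate on $H^*(\mathcal A)$. It induces a (possibly degenerate) pairing on $\mathcal A^*$ by $\langle\alpha,\beta\rangle=\int[\alpha\cdot\beta]$ if $|\alpha|+|\beta|=n$, and $0$ otherwise. $\mathcal A^*$ is $(r-1)$-connected if $H^0(\mathcal A)=\mathbb F$ and $H^i(\mathcal A)=0$ for $0<i<r$. A Hodge homotopy is a degree $-1$ linear operator $d^-\colon\mathcal A^*\to\mathcal A^{*-1}$ with $(d^-)^2=0$, $d^-dd^-=d^-$, $dd^-d=d$, $\langle\operatorname{Im}d^-,\operatorname{Im}d^-\rangle=0$ and $\langle\operatorname{Im}\pi_{\mathcal H^*},\operatorname{Im}d^-\rangle=0$, where $\pi_{\mathcal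 H^*}=\mathrm{id}-dd^--d^-d$. Its harmonic subspace is $\mathcal H^*=\operatorname{Im}\pi_{\mathcal H^*}$; the map $\alpha\mapsto[\alpha]$ is an isomorphism $\mathcal H^*\cong H^*(\mathcal A)$. The transferred minimal unital cyclic $C_\infty$-algebra has $m_1=0$ and $m_k=\pi_{\mathcal H^*}\circ\widehat m_k$ on $\mathcal H^*$, transported to $H^*(\mathcal A)$ by this isomorphism, where $\widehat m_2(\alpha_1,\alpha_2)=\alpha_1\cdot\alpha_2$ and for $k\ge3$ $$\begin{aligned}\widehat m_k(\alpha_1,\dots,\alpha_k)={}&(-1)^{k-1}d^-\widehat m_{k-1}(\alpha_1,\dots,\alpha_{k-1})\cdot\alpha_k-(-1)^{k|\alpha_1|}\alpha_1\cdot d^-\widehat m_{k-1}(\alpha_2,\dots,\alpha_k)\\&-\sum_{i=2}^{k-2}(-1)^{\nu}d^-\widehat m_i(\alpha_1,\dots,\alpha_i)\cdot d^-\widehat m_{k-i}(\alpha_{i+1},\dots,\alpha_k),\end{aligned}$$ with $\nu=i+(k-i-1)(|\alpha_1|+\cdots+|\alpha_i|)$. *)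

theory Defs
  imports Complex_Main
begin

text \<open>
  The underlying algebra is the whole type \<open>'a\<close>, made into an \<open>'f\<close>-algebra by \<open>scale\<close>.
  The grading is indexed by natural numbers, with \<open>A k = {0}\<close> for \<open>k > n\<close>, so that the
  assumption \<open>grading\<close> says \<open>'a = A 0 \<oplus> \<dots> \<oplus> A n\<close>.
\<close>

locale dgca = vector_space scale
  for scale :: "'f::field_char_0 \<Rightarrow> 'a::ring_1 \<Rightarrow> 'a" (infixr "*s" 75) +
  fixes n :: nat
    and A :: "nat \<Rightarrow> 'a set"
    and d :: "'a \<Rightarrow> 'a"
  assumes scale_mult_left: "(c *s x) * y = c *s (x * y)"
    and scale_mult_right: "x * (c *s y) = c *s (x * y)"
    and subspace_A: "subspace (A k)"
    and A_above: "k > n \<Longrightarrow> A k = {0}"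
    and grading: "\<exists>!f. (\<forall>k. f k \<in> A k) \<and> x = (\<Sum>k\<le>n. f k)"
    and one_A: "1 \<in> A 0"
    and mult_A: "x \<in> A i \<Longrightarrow> y \<in> A j \<Longrightarrow> x * y \<in> A (i + j)"
    and graded_commute: "x \<in> A i \<Longrightarrow> y \<in> A j \<Longrightarrow> x * y = (-1) ^ (i * j) * (y * x)"
    and d_linear: "Vector_Spaces.linear scale scale d"
    and d_A: "x \<in> A k \<Longrightarrow> d x \<in> A (Suc k)"
    and d_d: "d (d x) = 0"
    and Leibniz: "x \<in> A i \<Longrightarrow> d (x * y) = d x * y + (-1) ^ i * (x * d y)"
begin

definition proj :: "nat \<Rightarrow> 'a \<Rightarrow> 'a" where
  "proj k x = (THE f. (\<forall>k. f k \<in> A k) \<and> x = (\<Sum>k\<le>n. f k)) k"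

text \<open>Degree of a nonzero homogeneous element (by convention, \<open>deg 0 = 0\<close>).\<close>

definition deg :: "'a \<Rightarrow> nat" where
  "deg x = (LEAST k. x \<in> A k)"

text \<open>Cohomology classes are cosets of the image of \<open>d\<close>.\<close>

definition cls :: "'a \<Rightarrow> 'a set" where
  "cls x = {x + d z | z. True}"

definition Htot :: "'a set set" where
  "Htot = cls ` {x. d x = 0}"

definition H :: "nat \<Rightarrow> 'a set set" where
  "H k = cls ` {x \<in> A k. d x = 0}"

text \<open>Operations induced on classes; the unions are over representatives. In \<open>h_mult\<close> only
  closed representatives occur when the arguments lie in \<open>Htot\<close>.\<close>

definition h_add :: "'a set \<Rightarrow> 'a set \<Rightarrow> 'a set" where
  "h_add X Y = (\<Union>x\<in>X. \<Union>y\<in>Y. cls (x + y))"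

definition h_scale :: "'f \<Rightarrow> 'a set \<Rightarrow> 'a set" where
  "h_scale c X = (\<Union>x\<in>X. cls (c *s x))"

definition h_mult :: "'a set \<Rightarrow> 'a set \<Rightarrow> 'a set" where
  "h_mult X Y = (\<Union>x\<in>X. \<Union>y\<in>Y. cls (x * y))"

definition h_proj :: "nat \<Rightarrow> 'a set \<Rightarrow> 'a set" where
  "h_proj k X = (\<Union>x\<in>X. cls (proj k x))"

definition h_subspace :: "'a set set \<Rightarrow> bool" where
  "h_subspace V \<longleftrightarrow> cls 0 \<in> V \<and> (\<forall>X\<in>V. \<forall>Y\<in>V. h_add X Y \<in> V) \<and> (\<forall>c. \<forall>X\<in>V. h_scale c X \<in> V)"

definition h_span :: "'a set set \<Rightarrow> 'a set set" where
  "h_span S = h_subspace hull S"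

definition h_basis :: "'a set set \<Rightarrow> 'a set set \<Rightarrow> bool" where
  "h_basis S V \<longleftrightarrow> finite S \<and> S \<subseteq> V \<and> h_span S = V \<and> (\<forall>X\<in>S. X \<notin> h_span (S - {X}))"

text \<open>Meaningful for finite-dimensional \<open>V\<close> only, as \<open>h_basis\<close> demands finiteness.\<close>

definition h_dim :: "'a set set \<Rightarrow> nat" where
  "h_dim V = card (SOME S. h_basis S V)"

text \<open>\<open>r\<close>-connectedness; \<open>H\<^sup>0 = \<F>\<close> means that the unit map is an isomorphism onto \<open>H 0\<close>.\<close>

definition h_connected :: "nat \<Rightarrow> bool" where
  "h_connected r \<longleftrightarrow> bij_betw (\<lambda>c. cls (c *s 1)) UNIV (H 0) \<and> (\<forall>i. 0 < i \<and> i \<le> r \<longrightarrow> H i = {cls 0})"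

text \<open>
  \<open>h_pair\<close> and \<open>pair\<close> are the bilinear extensions of the pairings given on homogeneous elements
  by integrating the product if the degrees add up to \<open>n\<close>, and by \<open>0\<close> otherwise: taking the
  degree \<open>n\<close> component of the product discards all other degrees. Every element of \<open>A n\<close> is
  closed, because \<open>A (n + 1) = {0}\<close>.
\<close>

definition h_pair :: "('a set \<Rightarrow> 'f) \<Rightarrow> 'a set \<Rightarrow> 'a set \<Rightarrow> 'f" where
  "h_pair integ X Y = integ (h_proj n (h_mult X Y))"

definition pair :: "('a set \<Rightarrow> 'f) \<Rightarrow> 'a \<Rightarrow> 'a \<Rightarrow> 'f" where
  "pair integ x y = integ (cls (proj n (x * y)))"

end

locale pdgca = dgca scale n A d
  for scale :: "'f::field_char_0 \<Rightarrow> 'a::ring_1 \<Rightarrow> 'a" (infixr "*s" 75) and n A d +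
  fixes integ :: "'a set \<Rightarrow> 'f"
  assumes finite_dim: "\<exists>S. finite S \<and> S \<subseteq> Htot \<and> h_span S = Htot"
    and integ_add: "X \<in> H n \<Longrightarrow> Y \<in> H n \<Longrightarrow> integ (h_add X Y) = integ X + integ Y"
    and integ_scale: "X \<in> H n \<Longrightarrow> integ (h_scale c X) = c * integ X"
    and nondegenerate_left:
      "X \<in> Htot \<Longrightarrow> (\<And>Y. Y \<in> Htot \<Longrightarrow> h_pair integ X Y = 0) \<Longrightarrow> X = cls 0"
    and nondegenerate_right:
      "Y \<in> Htot \<Longrightarrow> (\<And>X. X \<in> Htot \<Longrightarrow> h_pair integ X Y = 0) \<Longrightarrow> Y = cls 0"

locale hodge_homotopy = pdgca scale n A d integ
  for scale :: "'f::field_char_0 \<Rightarrow> 'a::ring_1 \<Rightarrow> 'a" (infixr "*s" 75) and n A d integ +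
  fixes dm :: "'a \<Rightarrow> 'a"
  assumes dm_linear: "Vector_Spaces.linear scale scale dm"
    and dm_A_Suc: "x \<in> A (Suc k) \<Longrightarrow> dm x \<in> A k"
    and dm_A_0: "x \<in> A 0 \<Longrightarrow> dm x = 0"
    and dm_dm: "dm (dm x) = 0"
    and dm_d_dm: "dm (d (dm x)) = dm x"
    and d_dm_d: "d (dm (d x)) = d x"
    and pair_dm_dm: "pair integ (dm x) (dm y) = 0"
    and pair_harm_dm: "pair integ (x - d (dm x) - dm (d x)) (dm y) = 0"
begin

definition pi_harm :: "'a \<Rightarrow> 'a" where
  "pi_harm x = x - d (dm x) - dm (d x)"

definition Harm :: "'a set" where
  "Harm = range pi_harm"

definition harm_rep :: "'a set \<Rightarrow> 'a" where
  "harm_rep X = (THE x. x \<in> X \<and> x \<in> Harm)"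

text \<open>
  The operation \<open>m\<^sub>k\<close> with a hat on lists of \<open>k\<close> homogeneous elements. List positions start at
  \<open>0\<close>, so \<open>xs ! 0\<close> is the first argument. The value on lists of length below \<open>2\<close> is a dummy.
\<close>

function mhat :: "'a list \<Rightarrow> 'a" where
  "mhat xs = (let k = length xs in
     if k < 2 then 0
     else if k = 2 then xs ! 0 * xs ! 1
     else (-1) ^ (k - 1) * (dm (mhat (take (k - 1) xs)) * xs ! (k - 1))
        - (-1) ^ (k * deg (xs ! 0)) * (xs ! 0 * dm (mhat (drop 1 xs)))
        - (\<Sum>i = 2..k - 2. (-1) ^ (i + (k - i - 1) * (\<Sum>j<i. deg (xs ! j)))
             * (dm (mhat (take i xs)) * dm (mhat (drop i xs)))))"
  by auto
termination
  by (relation "measure length") auto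

declare mhat.simps [simp del]

text \<open>Multilinear extension to arbitrary arguments: decompose each one into its homogeneous
  components and sum over all choices of degrees.\<close>

definition mhat_ext :: "'a list \<Rightarrow> 'a" where
  "mhat_ext xs = (\<Sum>ps | length ps = length xs \<and> set ps \<subseteq> {..n}. mhat (map2 proj ps xs))"

text \<open>The transferred operation \<open>m\<^sub>k\<close> on \<open>k\<close> cohomology classes, \<open>k = length Xs\<close>.\<close>

definition transferred :: "'a set list \<Rightarrow> 'a set" where
  "transferred Xs =
     (if length Xs = 1 then cls 0 else cls (pi_harm (mhat_ext (map harm_rep Xs))))"

end

end

theory Submission
  imports Defs
begin

text \<open>
  A class is zero as soon as it pairs to zero with every class, so \<open>m\<^sub>k(a\<^sub>1,\<dots>,a\<^sub>k)\<close> is tested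
  against harmonic elements \<open>w\<close> of complementary degree; by orthogonality of the harmonic
  elements and the image of \<open>d\<^sup>-\<close> the projection may be dropped, which leaves the number
  \<open>\<integral> mhat(a\<^sub>1,\<dots>,a\<^sub>k) w\<close>.

  Arguments in degree \<open>0\<close> are multiples of \<open>1\<close> and kill the operation, because then \<open>mhat\<close>
  takes values in the image of \<open>d\<^sup>-\<close> (\<open>dm_mhat_scalar\<close>). If \<open>w\<close> is a multiple of \<open>1\<close>, the number is a
  sum of pairings of the image of \<open>d\<^sup>-\<close> with itself or with harmonic elements, all zero
  (\<open>integral_mhat\<close>). By connectedness every other harmonic element has degree at least \<open>r\<close>. Since
  \<open>mhat\<close> of \<open>k\<close> arguments lowers the total degree by \<open>k - 2\<close>, the \<open>k + 1\<close> degrees of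
  \<open>a\<^sub>1,\<dots>,a\<^sub>k,w\<close> add up to \<open>n + k - 2 \<le> 5 r + k - 4\<close>, which for \<open>r \<ge> 2\<close> and \<open>k \<ge> 4\<close> leaves only
  \<open>k = 4\<close> with all five degrees equal to \<open>r\<close> (\<open>pi_harm_mhat_zero\<close>).

  In this extremal case all five elements lie in the space \<open>V\<close> of harmonic elements of degree \<open>r\<close>, of
  dimension at most two. Moving \<open>d\<^sup>-\<close> across the pairing turns the number into the cyclic sum of
  the values of the five planar trivalent trees with five leaves (\<open>integral_mhat_four\<close>). Behind
  the vanishing is the fact that the representation of the symmetric group on five letters which is
  carried by cyclic Lie words is irreducible of type \<open>(3,1,1)\<close>, a shape equal to its own transpose:
  for either parity of \<open>r\<close> the form factors through a Schur functor with three rows, which is zero on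
  a space of dimension at most two. In the proof this is made explicit by expanding the five
  tree values in two spanning vectors of \<open>V\<close> (\<open>tree_form_cyclic_sum_zero\<close>).
\<close>

section \<open>Homogeneous components and cohomology classes\<close>

context dgca
begin

interpretation d: Vector_Spaces.linear scale scale d
  by (rule d_linear)

lemma zero_in_A [simp]: "0 \<in> A k"
  using subspace_A by (rule subspace_0)

lemma neg_one_power_in_A: "x \<in> A k \<Longrightarrow> (-1) ^ e * x \<in> A k"
  by (cases "even e") (auto intro: subspace_neg[OF subspace_A])

lemma proj_in_A: "proj k x \<in> A k"
  and sum_proj: "(\<Sum>k\<le>n. proj k x) = x"
proof -
  have *: "(\<forall>k. proj k x \<in> A k) \<and> x = (\<Sum>k\<le>n. proj k x)"
    unfolding proj_def using theI'[OF grading[of x]] by simp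
  show "proj k x \<in> A k" using * by blast
  show "(\<Sum>k\<le>n. proj k x) = x" using * by simp
qed

lemma proj_unique:
  assumes "\<And>k. f k \<in> A k" "x = (\<Sum>k\<le>n. f k)"
  shows "proj k x = f k"
proof -
  have "f = (THE f. (\<forall>k. f k \<in> A k) \<and> x = (\<Sum>k\<le>n. f k))"
    by (rule the1_equality[symmetric, OF grading]) (use assms in blast)
  then show ?thesis unfolding proj_def by simp
qed

lemma proj_add: "proj k (x + y) = proj k x + proj k y"
  by (rule proj_unique)
    (auto simp: sum.distrib sum_proj intro: subspace_add[OF subspace_A] proj_in_A)

lemma proj_scale: "proj k (c *s x) = c *s proj k x"
  by (rule proj_unique)
    (auto simp: scale_sum_right[symmetric] sum_proj intro: subspace_scale[OF subspace_A] proj_in_A)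

lemma proj_homogeneous: "x \<in> A i \<Longrightarrow> proj k x = (if k = i then x else 0)"
proof (rule proj_unique)
  assume x: "x \<in> A i"
  then show "(if k = i then x else 0) \<in> A k" for k by simp
  show "x = (\<Sum>k\<le>n. if k = i then x else 0)"
    using x A_above[of i] by (cases "i \<le> n") auto
qed

lemma proj_zero [simp]: "proj k 0 = 0"
  using proj_homogeneous[of 0 0] by simp

lemma homogeneous_induct [case_names zero homogeneous add]:
  assumes "P 0" "\<And>k x. x \<in> A k \<Longrightarrow> P x" "\<And>x y. P x \<Longrightarrow> P y \<Longrightarrow> P (x + y)"
  shows "P x"
proof -
  have "P (\<Sum>k\<in>K. proj k x)" if "finite K" for K
    using that by induction (auto intro: assms proj_in_A)
  then show ?thesis by (metis finite_atMost sum_proj)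
qed

lemma deg_eq:
  assumes "x \<in> A k" "x \<noteq> 0"
  shows "deg x = k"
  unfolding deg_def
proof (rule Least_equality)
  fix j assume "x \<in> A j"
  then show "k \<le> j" using proj_homogeneous[of x j k] proj_homogeneous[of x k k] assms
    by (auto split: if_splits)
qed (fact assms(1))

lemma proj_d_Suc: "proj (Suc k) (d x) = d (proj k x)"
  by (induction x rule: homogeneous_induct)
    (auto simp: proj_homogeneous d_A[THEN proj_homogeneous] proj_add d.add)

lemma proj_d_0: "proj 0 (d x) = 0"
  by (induction x rule: homogeneous_induct)
    (auto simp: d_A[THEN proj_homogeneous] proj_add d.add)

lemma proj_closed: "d x = 0 \<Longrightarrow> d (proj k x) = 0"
  by (metis proj_d_Suc proj_zero)

lemma d_one: "d 1 = 0"
  using Leibniz[OF one_A, of 1] by simp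

text \<open>
  Products of an exact and a closed element are exact also for elements of mixed degree; this makes
  the product of classes independent of representatives.
\<close>

lemma exact_mult_closed:
  assumes "d y = 0"
  shows "d z * y = d (z * y)"
  by (induction z rule: homogeneous_induct) (auto simp: Leibniz assms d.add distrib_right)

lemma homogeneous_closed_mult_exact:
  assumes "x \<in> A k" "d x = 0"
  shows "x * d z = d ((-1) ^ k * (x * z))"
  using Leibniz[OF assms(1), of z] assms(2) by (cases "even k") (auto simp: d.neg)

lemma closed_mult_exact:
  assumes "d x = 0"
  shows "\<exists>w. x * d z = d w"
proof -
  have "x * d z = (\<Sum>k\<le>n. proj k x * d z)"
    by (metis sum_proj sum_distrib_right)
  also have "\<dots> = (\<Sum>k\<le>n. d ((-1) ^ k * (proj k x * z)))"
    using homogeneous_closed_mult_exact[OF proj_in_A proj_closed[OF assms]] by simp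
  finally show ?thesis by (metis d.sum)
qed

lemma self_in_cls: "x \<in> cls x"
  unfolding cls_def by (auto intro!: exI[of _ 0])

lemma in_cls: "y \<in> cls x \<longleftrightarrow> (\<exists>z. y = x + d z)"
  unfolding cls_def by blast

lemma cls_eq_iff: "cls x = cls y \<longleftrightarrow> (\<exists>z. x = y + d z)"
proof
  assume "cls x = cls y"
  then show "\<exists>z. x = y + d z" using self_in_cls[of x] unfolding in_cls[symmetric] by simp
next
  assume "\<exists>z. x = y + d z"
  then obtain z where z: "x = y + d z" ..
  have "y + d z + d w = y + d (z + w)" "y + d w = y + d z + d (w - z)" for w
    by (auto simp: d.add d.diff)
  then show "cls x = cls y" unfolding cls_def z by blast
qed

lemma h_add_cls: "h_add (cls x) (cls y) = cls (x + y)"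
proof -
  have "cls (x' + y') = cls (x + y)" if "x' \<in> cls x" "y' \<in> cls y" for x' y'
    using that unfolding cls_eq_iff in_cls by (metis d.add add.assoc add.left_commute)
  then show ?thesis unfolding h_add_def using self_in_cls by blast
qed

lemma h_scale_cls: "h_scale c (cls x) = cls (c *s x)"
proof -
  have "cls (c *s x') = cls (c *s x)" if "x' \<in> cls x" for x'
    using that unfolding cls_eq_iff in_cls by (metis d.scale scale_right_distrib)
  then show ?thesis unfolding h_scale_def using self_in_cls by blast
qed

lemma h_proj_cls: "h_proj k (cls x) = cls (proj k x)"
proof -
  have "cls (proj k x') = cls (proj k x)" if "x' \<in> cls x" for x'
    using that unfolding cls_eq_iff in_cls
    by (metis d.zero not0_implies_Suc proj_add proj_d_0 proj_d_Suc)
  then show ?thesis unfolding h_proj_def using self_in_cls by blast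
qed

lemma h_mult_cls:
  assumes "d x = 0" "d y = 0"
  shows "h_mult (cls x) (cls y) = cls (x * y)"
proof -
  have "cls (x' * y') = cls (x * y)" if xy: "x' \<in> cls x" "y' \<in> cls y" for x' y'
  proof -
    obtain z w where z: "x' = x + d z" and w: "y' = y + d w" using xy unfolding in_cls by blast
    obtain v where v: "x * d w = d v" using closed_mult_exact[OF assms(1)] by blast
    have "d z * y' = d (z * y')" by (rule exact_mult_closed) (simp add: w assms d.add d_d)
    then have "x' * y' = x * y + d (v + z * y')"
      by (simp add: z w distrib_left distrib_right v d.add)
    then show ?thesis unfolding cls_eq_iff by blast
  qed
  then show ?thesis unfolding h_mult_def using self_in_cls by blast
qed

lemma h_subspace_cls_image:
  assumes "subspace V"
  shows "h_subspace (cls ` V)"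
  using assms unfolding h_subspace_def subspace_def by (auto simp: h_add_cls h_scale_cls)

text \<open>
  Preimages of class subspaces under \<open>cls\<close> are subspaces, so spans of classes can be computed on
  representatives; the two notions of span are thereby exchangeable.
\<close>

lemma h_span_cls_image: "h_span (cls ` S) = cls ` span S"
  unfolding h_span_def
proof (rule hull_unique)
  show "cls ` S \<subseteq> cls ` span S" by (intro image_mono span_superset)
  show "h_subspace (cls ` span S)" by (intro h_subspace_cls_image subspace_span)
  fix W assume W: "cls ` S \<subseteq> W" "h_subspace W"
  have "subspace {x. cls x \<in> W}"
    using W(2) unfolding h_subspace_def subspace_def by (auto simp flip: h_add_cls h_scale_cls)
  then have "span S \<subseteq> {x. cls x \<in> W}" using W(1) by (intro span_minimal) auto
  then show "cls ` span S \<subseteq> W" by blast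
qed

end

section \<open>Integration\<close>

context pdgca
begin

interpretation d: Vector_Spaces.linear scale scale d
  by (rule d_linear)

text \<open>
  The linear extension of the integral to all elements, by zero outside degree \<open>n\<close>. It turns the
  pairing into \<open>(x, y) \<mapsto> integral (x * y)\<close> and obeys Stokes' theorem.
\<close>

definition integral :: "'a \<Rightarrow> 'f" where
  "integral x = integ (cls (proj n x))"

lemma pair_eq_integral: "pair integ x y = integral (x * y)"
  unfolding pair_def integral_def ..

lemma top_class: "x \<in> A n \<Longrightarrow> cls x \<in> H n"
  unfolding H_def using d_A[of x n] A_above[of "Suc n"] by auto

lemma integral_add: "integral (x + y) = integral x + integral y"
  unfolding integral_def proj_add h_add_cls[symmetric]
  by (intro integ_add top_class proj_in_A)

lemma integral_scale: "integral (c *s x) = c * integral x"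
  unfolding integral_def proj_scale h_scale_cls[symmetric]
  by (intro integ_scale top_class proj_in_A)

lemma integral_zero [simp]: "integral 0 = 0"
  using integral_scale[of 0 0] by simp

lemma integral_minus [simp]: "integral (- x) = - integral x"
  using integral_add[of x "- x"] by (simp add: eq_neg_iff_add_eq_0 add.commute)

lemma integral_diff: "integral (x - y) = integral x - integral y"
  using integral_add[of x "- y"] by simp

lemma integral_sum: "integral (\<Sum>i\<in>I. f i) = (\<Sum>i\<in>I. integral (f i))"
  by (induction I rule: infinite_finite_induct) (auto simp: integral_add)

lemma integral_neg_one_power: "integral ((-1) ^ e * x) = (-1) ^ e * integral x"
  by (cases "even e") auto

lemma integral_off_degree: "x \<in> A k \<Longrightarrow> k \<noteq> n \<Longrightarrow> integral x = 0"
  using integral_zero by (simp add: integral_def proj_homogeneous)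

lemma integral_d [simp]: "integral (d x) = 0"
proof -
  have "\<exists>w. proj n (d x) = d w"
    by (metis d.zero not0_implies_Suc proj_d_0 proj_d_Suc)
  then have "cls (proj n (d x)) = cls 0" unfolding cls_eq_iff by auto
  then show ?thesis using integral_zero by (simp add: integral_def)
qed

lemma exact_if_orthogonal_to_closed:
  assumes "d x = 0" "\<And>y. d y = 0 \<Longrightarrow> integral (x * y) = 0"
  shows "cls x = cls 0"
proof (rule nondegenerate_left)
  show "cls x \<in> Htot" using assms(1) unfolding Htot_def by blast
  fix Y assume "Y \<in> Htot"
  then obtain y where "Y = cls y" "d y = 0" unfolding Htot_def by blast
  then show "h_pair integ (cls x) Y = 0"
    using assms by (simp add: h_pair_def h_mult_cls h_proj_cls integral_def)
qed

lemma integral_commute: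
  assumes "x \<in> A i" "y \<in> A j"
  shows "integral (x * y) = (-1) ^ (i * j) * integral (y * x)"
  by (simp add: graded_commute[OF assms] integral_neg_one_power)

end

section \<open>Harmonic elements\<close>

context hodge_homotopy
begin

interpretation d: Vector_Spaces.linear scale scale d
  by (rule d_linear)

interpretation dm: Vector_Spaces.linear scale scale dm
  by (rule dm_linear)

lemma pi_harm_linear: "Vector_Spaces.linear scale scale pi_harm"
  unfolding linear_iff_module_hom
  by unfold_locales
    (auto simp: pi_harm_def d.add dm.add d.scale dm.scale scale_right_diff_distrib)

interpretation ph: Vector_Spaces.linear scale scale pi_harm
  by (rule pi_harm_linear)

lemma d_pi_harm: "d (pi_harm x) = 0"
  and dm_pi_harm: "dm (pi_harm x) = 0"
  and pi_harm_d: "pi_harm (d x) = 0"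
  and pi_harm_dm: "pi_harm (dm x) = 0"
  by (simp_all add: pi_harm_def d.diff dm.diff d_d dm_dm d_dm_d dm_d_dm)

lemma Harm_iff: "x \<in> Harm \<longleftrightarrow> d x = 0 \<and> dm x = 0"
proof
  assume "x \<in> Harm" then show "d x = 0 \<and> dm x = 0"
    unfolding Harm_def using d_pi_harm dm_pi_harm by auto
next
  assume "d x = 0 \<and> dm x = 0" then have "x = pi_harm x" by (simp add: pi_harm_def)
  then show "x \<in> Harm" unfolding Harm_def by blast
qed

lemma pi_harm_Harm: "x \<in> Harm \<Longrightarrow> pi_harm x = x"
  by (simp add: Harm_iff pi_harm_def)

lemma subspace_Harm: "subspace Harm"
  by (auto simp: subspace_def Harm_iff d.add dm.add d.scale dm.scale)

lemma proj_dm: "proj k (dm x) = dm (proj (Suc k) x)"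
proof (induction x rule: homogeneous_induct)
  case (homogeneous i x)
  show ?case
  proof (cases i)
    case 0
    then show ?thesis using homogeneous dm_A_0 by (simp add: proj_homogeneous)
  next
    case (Suc j)
    then show ?thesis
      using homogeneous dm_A_Suc[of x j] by (auto simp: proj_homogeneous)
  qed
qed (auto simp: proj_add dm.add)

lemma dm_in_A: "x \<in> A k \<Longrightarrow> dm x \<in> A (k - 1)"
  by (cases k) (auto intro: dm_A_Suc simp: dm_A_0)

lemma pi_harm_in_A: "x \<in> A k \<Longrightarrow> pi_harm x \<in> A k"
  unfolding pi_harm_def
proof (intro subspace_diff[OF subspace_A])
  assume x: "x \<in> A k"
  show "d (dm x) \<in> A k" using x dm_A_0 d_A[OF dm_A_Suc] by (cases k) auto
  show "dm (d x) \<in> A k" using x by (intro dm_A_Suc d_A)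
qed

lemma proj_Harm: "x \<in> Harm \<Longrightarrow> proj k x \<in> Harm"
  unfolding Harm_iff using proj_closed proj_dm
  by (metis dm_A_0 not0_implies_Suc proj_in_A proj_zero)

lemma closed_cohomologous_pi_harm: "d x = 0 \<Longrightarrow> cls (pi_harm x) = cls x"
  unfolding cls_eq_iff
  by (rule exI[of _ "- dm x"]) (simp add: pi_harm_def d.neg)

lemma Harm_cls_inject:
  assumes "x \<in> Harm" "y \<in> Harm" "cls x = cls y"
  shows "x = y"
  using assms pi_harm_Harm unfolding cls_eq_iff by (metis add.right_neutral ph.add pi_harm_d)

text \<open>
  The description of the representative is proper: a closed element is cohomologous to its projection,
  and distinct harmonic elements have distinct classes.
\<close>

lemma harm_rep_in_Harm:
  assumes "X \<in> Htot"
  shows "harm_rep X \<in> Harm"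
proof -
  obtain x where x: "X = cls x" "d x = 0" using assms unfolding Htot_def by blast
  have "pi_harm x \<in> X \<and> pi_harm x \<in> Harm"
    using closed_cohomologous_pi_harm[OF x(2)] self_in_cls[of "pi_harm x"] x(1)
    by (auto simp: Harm_def)
  moreover have "y = pi_harm x" if "y \<in> X \<and> y \<in> Harm" for y
    using that Harm_cls_inject[of y "pi_harm x"] closed_cohomologous_pi_harm[OF x(2)] x(1)
    by (auto simp: Harm_def in_cls cls_eq_iff)
  ultimately show ?thesis unfolding harm_rep_def by (metis (mono_tags, lifting) theI)
qed

lemma one_Harm: "1 \<in> Harm"
  by (simp add: Harm_iff d_one dm_A_0 one_A)

lemma Harm_zero_if_no_cohomology:
  assumes "H k = {cls 0}" "x \<in> Harm" "x \<in> A k"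
  shows "x = 0"
proof (rule Harm_cls_inject)
  have "cls x \<in> H k" unfolding H_def using assms Harm_iff by blast
  then show "cls x = cls 0" using assms(1) by simp
qed (use assms in \<open>simp_all add: Harm_iff\<close>)

lemma Harm_0_scalar:
  assumes "bij_betw (\<lambda>c. cls (c *s 1)) UNIV (H 0)" "x \<in> Harm" "x \<in> A 0"
  shows "\<exists>c. x = c *s 1"
proof -
  have "cls x \<in> H 0" unfolding H_def using assms Harm_iff by blast
  then obtain c where "cls x = cls (c *s 1)" using assms(1) unfolding bij_betw_def by blast
  then show ?thesis
    using Harm_cls_inject assms(2) subspace_scale[OF subspace_Harm one_Harm] by blast
qed

section \<open>The homotopy and the pairing\<close>

lemma integral_dm_dm: "integral (dm x * dm y) = 0"
  using pair_dm_dm pair_eq_integral by simp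

lemma integral_Harm_dm: "w \<in> Harm \<Longrightarrow> integral (w * dm y) = 0"
  using pair_harm_dm[of w y] by (simp add: Harm_iff pair_eq_integral)

text \<open>
  Orthogonality with the arguments exchanged. The pairing is graded symmetric on homogeneous elements
  only, hence the decomposition of \<open>x\<close>, and this requires \<open>w\<close> to have a degree.
\<close>

lemma integral_dm_Harm:
  assumes "w \<in> Harm" "w \<in> A j"
  shows "integral (dm x * w) = 0"
proof (induction x rule: homogeneous_induct)
  case (homogeneous k x)
  then show ?case
    using integral_commute[OF dm_in_A assms(2)] integral_Harm_dm[OF assms(1)] by simp
qed (auto simp: dm.add distrib_right integral_add)

text \<open>
  The homotopy is self-adjoint up to sign: by the Hodge decomposition and the orthogonality relations
  only the part \<open>d (dm y)\<close> of \<open>y\<close> and the part \<open>d (dm x)\<close> of \<open>x\<close> are seen by the two integrals, and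
  these are related by Stokes' theorem for \<open>dm x * dm y\<close>.
\<close>

lemma integral_dm_adjoint:
  assumes "x \<in> A (Suc k)" "y \<in> A j"
  shows "integral (dm x * y) = (-1) ^ Suc k * integral (x * dm y)"
proof -
  have pix: "integral (pi_harm z * dm w) = 0" for z w
    by (rule integral_Harm_dm) (simp add: Harm_def)
  have piy: "integral (dm x * pi_harm y) = 0"
    using assms(2) by (intro integral_dm_Harm pi_harm_in_A) (auto simp: Harm_def)
  have "dm x * y = dm x * pi_harm y + dm x * d (dm y) + dm x * dm (d y)"
    by (simp add: pi_harm_def algebra_simps)
  then have "integral (dm x * y) = integral (dm x * d (dm y))"
    by (simp add: integral_add piy integral_dm_dm)
  moreover have "integral (d (dm x) * dm y) = integral (x * dm y)"
  proof -
    have "x * dm y = pi_harm x * dm y + d (dm x) * dm y + dm (d x) * dm y"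
      by (simp add: pi_harm_def algebra_simps)
    then show ?thesis by (simp add: integral_add pix integral_dm_dm)
  qed
  moreover have "integral (d (dm x) * dm y) + (-1) ^ k * integral (dm x * d (dm y)) = 0"
    using integral_d[of "dm x * dm y"] Leibniz[OF dm_A_Suc[OF assms(1)], of "dm y"]
    by (simp add: integral_add integral_neg_one_power)
  ultimately show ?thesis
    by (cases "even k") (auto simp: eq_neg_iff_add_eq_0 add.commute)
qed

lemma integral_pi_harm_Harm:
  assumes "x \<in> A i" "w \<in> Harm" "w \<in> A j"
  shows "integral (pi_harm x * w) = integral (x * w)"
proof -
  have "d (dm x) * w = d (dm x * w)" using assms(2) by (intro exact_mult_closed) (simp add: Harm_iff)
  then show ?thesis using integral_dm_Harm[OF assms(2,3)]
    by (simp add: pi_harm_def left_diff_distrib integral_diff)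
qed

text \<open>
  Poincare duality on harmonic elements: every closed element differs from a harmonic one by an
  exact one, so harmonic test elements of complementary degree suffice.
\<close>

lemma Harm_zero_if_orthogonal:
  assumes "u \<in> Harm" "u \<in> A s"
    and "\<And>q w. s + q = n \<Longrightarrow> w \<in> Harm \<Longrightarrow> w \<in> A q \<Longrightarrow> integral (u * w) = 0"
  shows "u = 0"
proof (rule Harm_cls_inject)
  have du: "d u = 0" using assms(1) by (simp add: Harm_iff)
  show "cls u = cls 0"
  proof (rule exact_if_orthogonal_to_closed[OF du])
    fix y assume y: "d y = 0"
    have "integral (u * proj q y) = 0" for q
    proof (cases "s + q = n")
      case False
      then show ?thesis by (intro integral_off_degree[OF mult_A[OF assms(2) proj_in_A]])
    next
      case True
      have "u * proj q y = u * pi_harm (proj q y) + u * d (dm (proj q y))"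
        using proj_closed[OF y] by (simp add: pi_harm_def algebra_simps)
      moreover have "integral (u * pi_harm (proj q y)) = 0"
        using True by (rule assms(3)) (auto simp: Harm_def intro: pi_harm_in_A proj_in_A)
      moreover have "integral (u * d (dm (proj q y))) = 0"
        by (metis closed_mult_exact[OF du] integral_d)
      ultimately show ?thesis by (simp add: integral_add)
    qed
    then have "integral (\<Sum>q\<le>n. u * proj q y) = 0" by (simp add: integral_sum)
    then show "integral (u * y) = 0" by (metis sum_distrib_left sum_proj)
  qed
qed (use assms(1) in \<open>simp_all add: Harm_iff\<close>)

lemma H_eq_cls_Harm: "H k = cls ` (Harm \<inter> A k)"
proof
  show "H k \<subseteq> cls ` (Harm \<inter> A k)"
  proof
    fix X assume "X \<in> H k"
    then obtain x where x: "x \<in> A k" "d x = 0" "X = cls x" unfolding H_def by blast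
    then have "X = cls (pi_harm x)" by (simp add: closed_cohomologous_pi_harm)
    then show "X \<in> cls ` (Harm \<inter> A k)"
      using pi_harm_in_A[OF x(1)] by (auto simp: Harm_def)
  qed
  show "cls ` (Harm \<inter> A k) \<subseteq> H k" unfolding H_def by (auto simp: Harm_iff)
qed

lemma inj_on_cls_Harm: "inj_on cls Harm"
  by (rule inj_onI) (rule Harm_cls_inject)

lemma Harm_finite_span: "\<exists>S. finite S \<and> Harm \<subseteq> span S"
proof -
  obtain S where S: "finite S" "S \<subseteq> Htot" "h_span S = Htot" using finite_dim by blast
  obtain S' where S': "finite S'" "S = cls ` S'"
    using finite_subset_image[OF S(1) S(2)[unfolded Htot_def]] by blast
  have "Harm \<subseteq> span (pi_harm ` S')"
  proof
    fix z assume z: "z \<in> Harm"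
    then have "cls z \<in> Htot" unfolding Htot_def by (auto simp: Harm_iff)
    then obtain w where "w \<in> span S'" "cls z = cls w"
      using S(3) unfolding S'(2) h_span_cls_image by blast
    moreover from this have "pi_harm z = pi_harm w"
      unfolding cls_eq_iff by (auto simp: ph.add pi_harm_d)
    ultimately show "z \<in> span (pi_harm ` S')"
      using pi_harm_Harm[OF z] by (auto simp: ph.span_image)
  qed
  then show ?thesis using S'(1) by blast
qed

text \<open>
  The dimension of cohomology is the size of a chosen basis, so it is meaningful only once some
  basis is known to exist. The classes of a basis of the harmonic elements form one.
\<close>

lemma h_basis_H_exists: "\<exists>S. h_basis S (H k)"
proof -
  let ?V = "Harm \<inter> A k"
  obtain B where B: "B \<subseteq> ?V" "independent B" "?V \<subseteq> span B" by (metis basis_exists)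
  have V: "subspace ?V" by (intro subspace_inter subspace_Harm subspace_A)
  have spB: "span B = ?V" using span_subspace[OF B(1,3) V] .
  obtain S where S: "finite S" "Harm \<subseteq> span S" using Harm_finite_span by blast
  have finB: "finite B" using independent_span_bound[OF S(1) B(2)] B(1) S(2) by blast
  have "X \<notin> h_span (cls ` B - {X})" if XB: "X \<in> cls ` B" for X
  proof
    assume X: "X \<in> h_span (cls ` B - {X})"
    obtain b where b: "b \<in> B" "X = cls b" using XB by blast
    have "cls ` B - {X} = cls ` (B - {b})"
      using inj_on_image_set_diff[OF inj_on_cls_Harm, of B "{b}"] B(1) b by auto
    then obtain w where w: "w \<in> span (B - {b})" "cls b = cls w"
      using X b(2) by (auto simp: h_span_cls_image)
    have "w \<in> Harm" "b \<in> Harm" using w(1) span_mono[of "B - {b}" B] spB b(1) B(1) by blast+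
    then have "b \<in> span (B - {b})" using Harm_cls_inject w by metis
    then show False using B(2) b(1) unfolding dependent_def by blast
  qed
  then have "h_basis (cls ` B) (H k)"
    unfolding h_basis_def using finB B(1) spB by (auto simp: H_eq_cls_Harm h_span_cls_image)
  then show ?thesis ..
qed

lemma Harm_span_two:
  assumes "h_dim (H k) \<le> 2"
  obtains x y where "x \<in> Harm \<inter> A k" "y \<in> Harm \<inter> A k" "Harm \<inter> A k \<subseteq> span {x, y}"
proof -
  let ?V = "Harm \<inter> A k"
  define S where "S = (SOME S. h_basis S (H k))"
  have "h_basis S (H k)" unfolding S_def using h_basis_H_exists by (rule someI_ex)
  then have S: "finite S" "S \<subseteq> cls ` ?V" "h_span S = cls ` ?V"
    unfolding h_basis_def H_eq_cls_Harm by blast+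
  obtain U where U: "U \<subseteq> ?V" "inj_on cls U" "S = cls ` U"
    using S(2) unfolding subset_image_inj by blast
  have "card U \<le> 2" using assms U unfolding h_dim_def S_def[symmetric] by (simp add: card_image)
  moreover have finU: "finite U" using S(1) U by (simp add: finite_image_iff)
  ultimately have "card U = 0 \<or> card U = 1 \<or> card U = 2" by linarith
  \<comment> \<open>A basis with fewer than two elements is padded by \<open>0\<close> or by repetition.\<close>
  then have "\<exists>x\<in>insert 0 U. \<exists>y\<in>insert 0 U. U \<subseteq> {x, y}"
    using finU by (auto simp: card_1_singleton_iff card_2_iff)
  then obtain x y where xy: "x \<in> insert 0 U" "y \<in> insert 0 U" "U \<subseteq> {x, y}" by blast
  have V: "subspace ?V" by (intro subspace_inter subspace_Harm subspace_A)
  have "?V \<subseteq> span U"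
  proof
    fix z assume z: "z \<in> ?V"
    then obtain w where w: "w \<in> span U" "cls z = cls w"
      using S(3) unfolding U(3) h_span_cls_image by blast
    moreover have "w \<in> ?V" using w(1) span_minimal[OF U(1) V] by blast
    ultimately show "z \<in> span U" using Harm_cls_inject z by blast
  qed
  also have "\<dots> \<subseteq> span {x, y}" using xy(3) by (rule span_mono)
  finally show thesis using xy U(1) subspace_0[OF V] by (intro that[of x y]) auto
qed

section \<open>The recursive operations\<close>

lemma mhat_short: "length xs < 2 \<Longrightarrow> mhat xs = 0"
  by (subst mhat.simps) simp

lemma mhat_two: "mhat [a, b] = a * b"
  by (subst mhat.simps) simp

lemma mhat_rec:
  assumes "3 \<le> length xs"
  shows "mhat xs = (-1) ^ (length xs - 1) * (dm (mhat (take (length xs - 1) xs)) * xs ! (length xs - 1))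
        - (-1) ^ (length xs * deg (xs ! 0)) * (xs ! 0 * dm (mhat (drop 1 xs)))
        - (\<Sum>i = 2..length xs - 2. (-1) ^ (i + (length xs - i - 1) * (\<Sum>j<i. deg (xs ! j)))
             * (dm (mhat (take i xs)) * dm (mhat (drop i xs))))"
  using assms by (subst mhat.simps) (simp add: Let_def)

lemma subspace_range_dm: "subspace (range dm)"
  using dm.subspace_image[OF subspace_UNIV] .

lemma neg_one_power_in_range_dm: "x \<in> range dm \<Longrightarrow> (-1) ^ e * x \<in> range dm"
  by (cases "even e") (auto intro: subspace_neg[OF subspace_range_dm])

lemma set_eq_insert_last:
  "xs \<noteq> [] \<Longrightarrow> set xs = insert (xs ! (length xs - 1)) (set (take (length xs - 1) xs))"
  by (cases xs rule: rev_cases) auto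

text \<open>
  Unitality. In the recursion a multiple of \<open>1\<close> occurs inside some factor \<open>dm (mhat \<dots>)\<close>, which
  vanishes by induction, unless it stands alone as the first or last factor; there it merely rescales the
  other factor, an element of the image of \<open>dm\<close>. The case of two arguments starts the
  induction because \<open>dm\<close> kills harmonic elements. For \<open>c = 0\<close> this covers zero arguments, whose
  degree is only conventional.
\<close>

lemma dm_mhat_scalar:
  assumes "set xs \<subseteq> Harm" "c *s 1 \<in> set xs"
  shows "dm (mhat xs) = 0 \<and> (3 \<le> length xs \<longrightarrow> mhat xs \<in> range dm)"
  using assms
proof (induction xs rule: length_induct)
  case (1 xs)
  let ?k = "length xs"
  have IH: "dm (mhat ys) = 0" if "length ys < ?k" "set ys \<subseteq> set xs" "c *s 1 \<in> set ys" for ys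
    using 1 that by blast
  show ?case
  proof (cases "3 \<le> ?k")
    case True
    have set_last: "set xs = insert (xs ! (?k - 1)) (set (take (?k - 1) xs))"
      using True by (intro set_eq_insert_last) auto
    have set_first: "set xs = insert (xs ! 0) (set (drop 1 xs))" using True by (cases xs) auto
    have "dm (mhat (take (?k - 1) xs)) * xs ! (?k - 1) \<in> range dm"
    proof (cases "c *s 1 \<in> set (take (?k - 1) xs)")
      case True
      then have "dm (mhat (take (?k - 1) xs)) = 0"
        using \<open>3 \<le> ?k\<close> by (intro IH) (auto dest: in_set_takeD)
      then show ?thesis using subspace_0[OF subspace_range_dm] by simp
    next
      case False
      then have "xs ! (?k - 1) = c *s 1" using set_last 1(3) by auto
      then show ?thesis
        using subspace_scale[OF subspace_range_dm] by (simp add: scale_mult_right)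
    qed
    moreover have "xs ! 0 * dm (mhat (drop 1 xs)) \<in> range dm"
    proof (cases "c *s 1 \<in> set (drop 1 xs)")
      case True
      then have "dm (mhat (drop 1 xs)) = 0"
        using \<open>3 \<le> ?k\<close> by (intro IH) (auto dest: in_set_dropD)
      then show ?thesis using subspace_0[OF subspace_range_dm] by simp
    next
      case False
      then have "xs ! 0 = c *s 1" using set_first 1(3) by auto
      then show ?thesis
        using subspace_scale[OF subspace_range_dm] by (simp add: scale_mult_left)
    qed
    moreover have "dm (mhat (take i xs)) * dm (mhat (drop i xs)) = 0" if "i \<in> {2..?k - 2}" for i
    proof -
      have "c *s 1 \<in> set (take i xs) \<or> c *s 1 \<in> set (drop i xs)"
        using 1(3) by (metis append_take_drop_id Un_iff set_append)
      then show ?thesis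
        using IH[of "take i xs"] IH[of "drop i xs"] that True set_take_subset[of i xs]
          set_drop_subset[of i xs] by auto
    qed
    ultimately have "mhat xs \<in> range dm"
      unfolding mhat_rec[OF True]
      by (auto intro!: subspace_diff[OF subspace_range_dm] neg_one_power_in_range_dm
          subspace_0[OF subspace_range_dm])
    then show ?thesis using dm_dm by auto
  next
    case False
    show ?thesis
    proof (cases "?k = 2")
      case True
      then obtain a b where xs: "xs = [a, b]"
        by (auto simp: numeral_2_eq_2 length_Suc_conv)
      then have "a = c *s 1 \<or> b = c *s 1" using 1(3) by auto
      moreover have "dm a = 0" "dm b = 0" using 1(2) xs by (auto simp: Harm_iff)
      ultimately show ?thesis
        unfolding xs mhat_two by (auto simp: scale_mult_left scale_mult_right dm.scale)
    next
      case 2: False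
      then show ?thesis using False by (simp add: mhat_short)
    qed
  qed
qed

lemma pi_harm_mhat_scalar:
  assumes "set xs \<subseteq> Harm" "c *s 1 \<in> set xs" "3 \<le> length xs"
  shows "pi_harm (mhat xs) = 0"
  using dm_mhat_scalar[OF assms(1,2)] assms(3) pi_harm_dm by auto

text \<open>
  The bound on the degrees keeps the truncated subtraction exact: every degree that \<open>dm\<close> acts on
  in the recursion is then at least \<open>2\<close>.
\<close>

lemma mhat_in_A:
  assumes "\<And>x. x \<in> set xs \<Longrightarrow> x \<in> A (deg x) \<and> 1 \<le> deg x" "2 \<le> length xs"
  shows "mhat xs \<in> A (sum_list (map deg xs) + 2 - length xs)"
  using assms
proof (induction xs rule: length_induct)
  case (1 xs)
  let ?D = "\<lambda>ys. sum_list (map deg ys)" and ?k = "length xs"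
  have D: "length ys \<le> ?D ys" if "set ys \<subseteq> set xs" for ys
    using that 1(2) by (induction ys) force+
  have IH: "dm (mhat ys) \<in> A (?D ys + 1 - length ys)"
    if "length ys < ?k" "set ys \<subseteq> set xs" "2 \<le> length ys" for ys
  proof -
    have "mhat ys \<in> A (?D ys + 2 - length ys)" using 1 that by blast
    then show ?thesis using dm_in_A by fastforce
  qed
  show ?case
  proof (cases "?k = 2")
    case True
    then obtain a b where xs: "xs = [a, b]"
      by (auto simp: numeral_2_eq_2 length_Suc_conv)
    show ?thesis using 1(2) mult_A[of a "deg a" b "deg b"] by (simp add: xs mhat_two)
  next
    case False
    then have k: "3 \<le> ?k" using 1(3) by simp
    have split: "?D xs = ?D (take i xs) + ?D (drop i xs)" for i
      by (metis append_take_drop_id map_append sum_list_append)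
    have last: "drop (?k - 1) xs = [xs ! (?k - 1)]"
      using k by (metis Cons_nth_drop_Suc One_nat_def Suc_pred diff_less drop_all le_refl
          length_greater_0_conv length_0_conv less_numeral_extra(1) not_numeral_le_zero)
    have first: "take 1 xs = [xs ! 0]" using k by (cases xs) auto
    have subs: "set (take i xs) \<subseteq> set xs" "set (drop i xs) \<subseteq> set xs" for i
      by (auto dest: in_set_takeD in_set_dropD)
    have mem: "x \<in> A j" if "x \<in> A i" "i = j" for x i j using that by simp
    have "dm (mhat (take (?k - 1) xs)) * xs ! (?k - 1) \<in> A (?D xs + 2 - ?k)"
    proof (rule mem[OF mult_A[OF IH]])
      show "xs ! (?k - 1) \<in> A (deg (xs ! (?k - 1)))" using 1(2) k by simp
      show "?D (take (?k - 1) xs) + 1 - length (take (?k - 1) xs) + deg (xs ! (?k - 1)) = ?D xs + 2 - ?k"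
        using split[of "?k - 1"] last k D[OF subs(1), of "?k - 1"] by simp
    qed (use k subs in auto)
    moreover have "xs ! 0 * dm (mhat (drop 1 xs)) \<in> A (?D xs + 2 - ?k)"
    proof (rule mem[OF mult_A[OF _ IH]])
      show "xs ! 0 \<in> A (deg (xs ! 0))" using 1(2) nth_mem[of 0 xs] k by fastforce
      show "deg (xs ! 0) + (?D (drop 1 xs) + 1 - length (drop 1 xs)) = ?D xs + 2 - ?k"
        using split[of 1] first k D[OF subs(2), of 1] by simp
    qed (use k subs in auto)
    moreover have "dm (mhat (take i xs)) * dm (mhat (drop i xs)) \<in> A (?D xs + 2 - ?k)"
      if i: "i \<in> {2..?k - 2}" for i
    proof (rule mem[OF mult_A[OF IH IH]])
      show "?D (take i xs) + 1 - length (take i xs) + (?D (drop i xs) + 1 - length (drop i xs))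
          = ?D xs + 2 - ?k"
        using split[of i] k i D[OF subs(1), of i] D[OF subs(2), of i] by simp
    qed (use k i subs in auto)
    ultimately show ?thesis
      unfolding mhat_rec[OF k]
      by (intro subspace_diff[OF subspace_A] subspace_sum[OF subspace_A] neg_one_power_in_A)
  qed
qed

text \<open>
  The pairing of \<open>mhat\<close> with the unit. Every summand of the recursion has a factor in the image of
  \<open>dm\<close>, and the other factor is harmonic or in the image of \<open>dm\<close> as well.
\<close>

lemma integral_mhat:
  assumes "\<And>x. x \<in> set xs \<Longrightarrow> x \<in> Harm \<and> x \<in> A (deg x)" "3 \<le> length xs"
  shows "integral (mhat xs) = 0"
proof -
  have "integral (dm (mhat (take (length xs - 1) xs)) * xs ! (length xs - 1)) = 0"
    using assms by (intro integral_dm_Harm[of _ "deg (xs ! (length xs - 1))"]) auto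
  moreover have "integral (xs ! 0 * dm (mhat (drop 1 xs))) = 0"
    using assms nth_mem[of 0 xs] by (intro integral_Harm_dm) fastforce
  ultimately show ?thesis
    unfolding mhat_rec[OF assms(2)] integral_diff integral_sum integral_neg_one_power
    by (simp add: integral_dm_dm)
qed

section \<open>The quaternary operation in the lowest degree\<close>

lemma mhat_three:
  "mhat [a, b, c] = dm (a * b) * c - (-1) ^ deg a * (a * dm (b * c))"
  by (cases "even (deg a)") (subst mhat_rec; simp add: mhat_two power_add)+

lemma mhat_four:
  "mhat [a, b, c, e] = - (dm (mhat [a, b, c]) * e) - a * dm (mhat [b, c, e])
     - (-1) ^ (deg a + deg b) * (dm (a * b) * dm (c * e))"
proof -
  have "{2..2::nat} = {2}" "{..<2::nat} = {0, 1}" by auto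
  then show ?thesis
    by (cases "even (deg a)") (subst mhat_rec; simp add: mhat_two numeral_eq_Suc power_add)+
qed

text \<open>
  The value of the planar trivalent tree with five leaves in which \<open>a, b\<close> and \<open>c, e\<close> are joined first
  and the results meet at the leaf \<open>f\<close>; \<open>dm\<close> sits on the two inner edges.
\<close>

definition tree_form :: "'a \<Rightarrow> 'a \<Rightarrow> 'a \<Rightarrow> 'a \<Rightarrow> 'a \<Rightarrow> 'f" where
  "tree_form a b c e f = integral (dm (a * b) * dm (c * e) * f)"

text \<open>
  Adjointness moves the outer \<open>dm\<close> onto \<open>e * f\<close>, and each of the two summands of the ternary
  operation becomes a tree after moving its loose leaf to the end.
\<close>

lemma integral_dm_mhat_three:
  assumes "{a, b, c, e, f} \<subseteq> A r" "deg a = r" "0 < r"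
  shows "integral (dm (mhat [a, b, c]) * e * f) = - tree_form a b e f c + tree_form b c e f a"
proof -
  have A: "a \<in> A r" "b \<in> A r" "c \<in> A r" "e \<in> A r" "f \<in> A r" using assms(1) by auto
  have dmA: "dm (x * y) \<in> A (2 * r - 1)" if "x \<in> A r" "y \<in> A r" for x y
    using dm_in_A[OF mult_A[OF that]] by (simp add: mult_2)
  obtain k where k: "r = Suc k" using assms(3) by (cases r) auto
  have m: "mhat [a, b, c] \<in> A (Suc (3 * r - 2))"
  proof -
    have "2 * r - 1 + r = Suc (3 * r - 2)" "r + (2 * r - 1) = Suc (3 * r - 2)" using k by auto
    then show ?thesis unfolding mhat_three
      by (metis A dmA mult_A subspace_diff[OF subspace_A] neg_one_power_in_A)
  qed
  have "integral (dm (mhat [a, b, c]) * (e * f))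
      = (-1) ^ Suc (3 * r - 2) * integral (mhat [a, b, c] * dm (e * f))"
    by (rule integral_dm_adjoint[OF m mult_A[OF A(4,5)]])
  also have "(-1 :: 'f) ^ Suc (3 * r - 2) = - ((-1) ^ r)" unfolding k by (cases "even k") auto
  also have "integral (mhat [a, b, c] * dm (e * f))
     = (-1) ^ r * tree_form a b e f c - (-1) ^ r * tree_form b c e f a"
  proof -
    have "c * dm (e * f) = (-1) ^ r * (dm (e * f) * c)"
      using graded_commute[OF A(3) dmA[OF A(4,5)]] unfolding k by (cases "even k") auto
    then have 1: "integral (dm (a * b) * c * dm (e * f)) = (-1) ^ r * tree_form a b e f c"
      unfolding tree_form_def by (cases "even r") (auto simp: mult.assoc)
    have "a * (dm (b * c) * dm (e * f)) = (dm (b * c) * dm (e * f)) * a"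
      using graded_commute[OF A(1) mult_A[OF dmA[OF A(2,3)] dmA[OF A(4,5)]]]
      unfolding k by (cases "even k") auto
    then have 2: "integral ((-1) ^ deg a * (a * dm (b * c)) * dm (e * f)) = (-1) ^ r * tree_form b c e f a"
      unfolding tree_form_def assms(2) by (cases "even r") (auto simp: mult.assoc)
    show ?thesis unfolding mhat_three left_diff_distrib integral_diff 1 2 ..
  qed
  finally show ?thesis by (cases "even r") (auto simp: mult.assoc)
qed

text \<open>
  The right-hand side is the orbit sum of one tree under cyclic rotation of \<open>a, b, c, e, f\<close>: the
  elements \<open>dm (a * b)\<close> have odd degree, so that \<open>tree_form\<close> changes sign when its two pairs
  are exchanged, and this accounts for the minus signs.
\<close>

lemma integral_mhat_four:
  assumes "{a, b, c, e, f} \<subseteq> A r" "deg a = r" "deg b = r" "0 < r"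
  shows "integral (mhat [a, b, c, e] * f) =
    tree_form a b e f c - tree_form b c e f a + tree_form b c f a e
    - tree_form c e f a b - tree_form a b c e f"
proof -
  have A: "a \<in> A r" "b \<in> A r" "c \<in> A r" "e \<in> A r" "f \<in> A r" using assms(1) by auto
  have "mhat [b, c, e] \<in> A (3 * r - 1)"
  proof -
    have "2 * r - 1 + r = 3 * r - 1" "r + (2 * r - 1) = 3 * r - 1" using assms(4) by auto
    moreover have "dm (x * y) \<in> A (2 * r - 1)" if "x \<in> A r" "y \<in> A r" for x y
      using dm_in_A[OF mult_A[OF that]] by (simp add: mult_2)
    ultimately show ?thesis unfolding mhat_three
      by (metis A mult_A subspace_diff[OF subspace_A] neg_one_power_in_A)
  qed
  then have m: "dm (mhat [b, c, e]) \<in> A (3 * r - 2)"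
    using dm_in_A[of "mhat [b, c, e]" "3 * r - 1"] by (simp add: numeral_2_eq_2)
  have "a * (dm (mhat [b, c, e]) * f) = dm (mhat [b, c, e]) * f * a"
  proof -
    have "even (r * (3 * r - 2 + r))" using assms(4) by (cases r) auto
    then show ?thesis using graded_commute[OF A(1) mult_A[OF m A(5)]] by simp
  qed
  then have 1: "integral (a * dm (mhat [b, c, e]) * f) = - tree_form b c f a e + tree_form c e f a b"
    using integral_dm_mhat_three[of b c e f a r] assms by (simp add: mult.assoc)
  have "(-1) ^ (deg a + deg b) * (dm (a * b) * dm (c * e)) = dm (a * b) * dm (c * e)"
    by (simp add: assms)
  then show ?thesis
    using integral_dm_mhat_three[OF assms(1,2,4)] 1
    by (simp add: mhat_four left_diff_distrib integral_diff tree_form_def)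
qed

text \<open>
  The trilinear form \<open>(u, v, w) \<mapsto> integral (u * v * w)\<close> is alternating in \<open>u, v\<close> on the span of
  \<open>p, q, s\<close>, so only the two-by-two minors of the coordinates enter.
\<close>

lemma integral_anticommuting_triple:
  assumes anti: "\<And>u v. u \<in> {p, q, s} \<Longrightarrow> v \<in> {p, q, s} \<Longrightarrow> u * v = - (v * u)"
  shows "integral ((u1 *s p + u2 *s q + u3 *s s) * (v1 *s p + v2 *s q + v3 *s s) * w)
    = (u1 * v2 - u2 * v1) * integral (p * q * w) + (u1 * v3 - u3 * v1) * integral (p * s * w)
      + (u2 * v3 - u3 * v2) * integral (q * s * w)"
proof -
  have sq: "integral (u * u * w) = 0" if "u \<in> {p, q, s}" for u
  proof -
    have "integral (u * u * w) = - integral (u * u * w)" using anti[OF that that]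
      by (metis integral_minus mult_minus_left)
    then show ?thesis by simp
  qed
  have left: "integral ((u1 *s p + u2 *s q + u3 *s s) * z * w)
      = u1 * integral (p * z * w) + u2 * integral (q * z * w) + u3 * integral (s * z * w)" for z
    by (simp add: distrib_right scale_mult_left integral_add integral_scale)
  have right: "integral (z * (v1 *s p + v2 *s q + v3 *s s) * w)
      = v1 * integral (z * p * w) + v2 * integral (z * q * w) + v3 * integral (z * s * w)" for z
    by (simp add: distrib_left distrib_right scale_mult_left scale_mult_right
        integral_add integral_scale)
  have "integral (q * p * w) = - integral (p * q * w)"
    "integral (s * p * w) = - integral (p * s * w)"
    "integral (s * q * w) = - integral (q * s * w)"
    using anti[of q p] anti[of s p] anti[of s q] by simp_all
  then show ?thesis
    unfolding left right by (simp add: sq) (simp add: algebra_simps)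
qed

text \<open>
  On the span of \<open>x, y\<close> the values \<open>dm (u * v)\<close> lie in the span of \<open>p = dm (x * x)\<close>, \<open>q = dm (x * y)\<close> and
  \<open>s = dm (y * y)\<close>. For odd \<open>r\<close> the squares \<open>x * x\<close> and \<open>y * y\<close> vanish, only \<open>q\<close> survives, and each tree is
  zero. For even \<open>r\<close> a single tree need not vanish: it is a combination of the six integrals of
  \<open>p * q\<close>, \<open>p * s\<close>, \<open>q * s\<close> against \<open>x\<close> and \<open>y\<close>, and their coefficients cancel in the cyclic sum.
\<close>

lemma tree_form_cyclic_sum_zero:
  assumes r: "0 < r" and xy: "x \<in> A r" "y \<in> A r" and abcef: "{a, b, c, e, f} \<subseteq> span {x, y}"
  shows "tree_form a b e f c - tree_form b c e f a + tree_form b c f a e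
    - tree_form c e f a b - tree_form a b c e f = 0"
proof -
  have dmA: "dm (u * v) \<in> A (2 * r - 1)" if "u \<in> {x, y}" "v \<in> {x, y}" for u v
    using dm_in_A[OF mult_A[of u r v r]] that xy by (auto simp: mult_2)
  have odd: "odd (2 * r - 1)" using r by simp
  define p q s where "p = dm (x * x)" and "q = dm (x * y)" and "s = dm (y * y)"
  have anti: "u * v = - (v * u)" if "u \<in> {p, q, s}" "v \<in> {p, q, s}" for u v
  proof -
    have "u \<in> A (2 * r - 1)" "v \<in> A (2 * r - 1)" using that dmA by (auto simp: p_def q_def s_def)
    then show ?thesis using graded_commute[of u "2 * r - 1" v "2 * r - 1"] odd by simp
  qed
  have triple: "integral ((u1 *s p + u2 *s q + u3 *s s) * (v1 *s p + v2 *s q + v3 *s s) * w)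
    = (u1 * v2 - u2 * v1) * integral (p * q * w) + (u1 * v3 - u3 * v1) * integral (p * s * w)
      + (u2 * v3 - u3 * v2) * integral (q * s * w)" for u1 u2 u3 v1 v2 v3 w
    by (rule integral_anticommuting_triple) (rule anti)
  have coord: "\<exists>g h. z = g *s x + h *s y" if "z \<in> span {x, y}" for z
  proof -
    from that obtain g where "z - g *s x \<in> span {y}" by (auto simp: span_breakdown_eq)
    then obtain h where "z - g *s x - h *s y = 0" by (auto simp: span_breakdown_eq)
    then have "z = g *s x + h *s y" by (simp add: algebra_simps)
    then show ?thesis by blast
  qed
  obtain a1 a2 b1 b2 c1 c2 e1 e2 f1 f2 where coords:
    "a = a1 *s x + a2 *s y" "b = b1 *s x + b2 *s y" "c = c1 *s x + c2 *s y"
    "e = e1 *s x + e2 *s y" "f = f1 *s x + f2 *s y"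
    using abcef coord by (metis insert_subset)
  have dm_prod: "dm ((g1 *s x + g2 *s y) * (h1 *s x + h2 *s y))
      = (g1 * h1) *s p + (g1 * h2 + (-1) ^ r * (g2 * h1)) *s q + (g2 * h2) *s s" for g1 g2 h1 h2
  proof -
    have "dm (y * x) = (-1) ^ r *s q"
      using graded_commute[OF xy(2,1)] by (cases "even r") (auto simp: q_def dm.neg)
    then show ?thesis
      by (simp add: distrib_left distrib_right scale_mult_left scale_mult_right dm.add dm.scale
          p_def s_def q_def[symmetric] scale_left_distrib scale_right_distrib add_ac mult_ac)
  qed
  have lin: "integral (z * (g *s x + h *s y)) = g * integral (z * x) + h * integral (z * y)" for z g h
    by (simp add: distrib_left scale_mult_right integral_add integral_scale)
  show ?thesis
  proof (cases "even r")
    case True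
    then have one: "(-1 :: 'f) ^ r = 1" by simp
    show ?thesis
      unfolding tree_form_def coords dm_prod lin triple one mult_1_left
      by algebra
  next
    case False
    then have "x * x = - (x * x)" "y * y = - (y * y)"
      using graded_commute[OF xy(1) xy(1)] graded_commute[OF xy(2) xy(2)] by auto
    have z0: "z = 0" if "z = - z" for z :: 'a
    proof -
      have "(2 :: 'f) *s z = z + z" by (metis one_add_one scale_left_distrib scale_one)
      also have "\<dots> = 0" using that by (metis ab_left_minus)
      finally show ?thesis by simp
    qed
    have "p = 0" "s = 0" using z0[OF \<open>x * x = _\<close>] z0[OF \<open>y * y = _\<close>] by (auto simp: p_def s_def)
    then show ?thesis
      unfolding tree_form_def coords dm_prod lin triple by simp
  qed
qed

section \<open>Vanishing of the higher operations\<close>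

text \<open>
  The test against harmonic elements \<open>w\<close> of degree \<open>q\<close>: below degree \<open>r\<close> such a \<open>w\<close> is a scalar, and the
  degree count leaves only the extremal case, where the cyclic sum of trees vanishes.
\<close>

lemma pi_harm_mhat_zero:
  assumes r: "2 \<le> r" and conn: "h_connected (r - 1)" and n: "n \<le> 5 * r - 2"
    and dim: "h_dim (H r) \<le> 2"
    and xs: "\<And>x. x \<in> set xs \<Longrightarrow> x \<in> Harm \<and> (\<exists>k. x \<in> A k)" and len: "4 \<le> length xs"
  shows "pi_harm (mhat xs) = 0"
proof (cases "\<exists>c. c *s 1 \<in> set xs")
  case True
  then show ?thesis using xs len by (auto intro: pi_harm_mhat_scalar)
next
  case nonscalar: False
  let ?k = "length xs"
  have low: "x \<in> Harm \<Longrightarrow> x \<in> A q \<Longrightarrow> q < r \<Longrightarrow> \<exists>c. x = c *s 1" for x q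
    using Harm_0_scalar[of x] Harm_zero_if_no_cohomology[of q x] conn
    unfolding h_connected_def by (cases "q = 0") (auto intro: exI[of _ 0])
  have deg: "x \<in> Harm \<and> x \<in> A (deg x) \<and> r \<le> deg x" if x: "x \<in> set xs" for x
  proof -
    obtain q where q: "x \<in> Harm" "x \<in> A q" using xs x by blast
    have ns: "x \<noteq> c *s 1" for c using nonscalar x by blast
    then have "x \<noteq> 0" using scale_zero_left by metis
    then have "deg x = q" using q deg_eq by blast
    then show ?thesis using q low ns by (metis not_le)
  qed
  define s where "s = sum_list (map deg xs) + 2 - ?k"
  have "length ys * r \<le> sum_list (map deg ys)" if "set ys \<subseteq> set xs" for ys
    using that deg by (induction ys) force+
  from this[of xs] have kr: "?k * r \<le> sum_list (map deg xs)" by simp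
  have "?k * 1 \<le> ?k * r" using r by (intro mult_le_mono) auto
  then have s: "s + ?k = sum_list (map deg xs) + 2" using kr unfolding s_def by linarith
  have mA: "mhat xs \<in> A s"
    unfolding s_def using deg r len by (intro mhat_in_A) force+
  show ?thesis
  proof (rule Harm_zero_if_orthogonal)
    show "pi_harm (mhat xs) \<in> Harm" by (simp add: Harm_def)
    show "pi_harm (mhat xs) \<in> A s" using mA by (rule pi_harm_in_A)
    fix q w assume q: "s + q = n" and w: "w \<in> Harm" "w \<in> A q"
    have "integral (mhat xs * w) = 0"
    proof (cases "q < r")
      case True
      then obtain c where "w = c *s 1" using low w by blast
      then show ?thesis
        using integral_mhat[of xs] deg len by (simp add: scale_mult_right integral_scale)
    next
      case False
      have tot: "sum_list (map deg xs) + q + 2 = n + ?k" using s q by simp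
      have "?k = 4"
      proof (rule ccontr)
        assume "?k \<noteq> 4"
        then have "5 \<le> ?k" using len by simp
        then obtain j where j: "?k = 5 + j" by (metis le_iff_add)
        \<comment> \<open>The \<open>k + 1\<close> degrees are at least \<open>r\<close> each, which is too much for \<open>k = 5 + j\<close>.\<close>
        have "(5 + j) * r + r + 2 \<le> 5 * r - 2 + (5 + j)" using kr tot n False unfolding j by linarith
        moreover have "j * 2 \<le> j * r" using r by (intro mult_le_mono) auto
        ultimately show False using r by (simp add: algebra_simps)
      qed
      then obtain a b c e where abce: "xs = [a, b, c, e]"
        by (auto simp: numeral_eq_Suc length_Suc_conv)
      \<comment> \<open>Five degrees of at least \<open>r\<close> with sum \<open>n + 2 \<le> 5 r\<close> are all equal to \<open>r\<close>.\<close>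
      have degs: "deg a = r \<and> deg b = r \<and> deg c = r \<and> deg e = r \<and> q = r"
      proof -
        have "r \<le> deg a" "r \<le> deg b" "r \<le> deg c" "r \<le> deg e"
          using deg unfolding abce by simp_all
        moreover have "deg a + deg b + deg c + deg e + q = n + 2"
          using tot unfolding abce by simp
        ultimately show ?thesis using r False n by (intro conjI; linarith)
      qed
      obtain x y where xy: "x \<in> Harm \<inter> A r" "y \<in> Harm \<inter> A r" "Harm \<inter> A r \<subseteq> span {x, y}"
        using Harm_span_two[OF dim] .
      have mem: "{a, b, c, e, w} \<subseteq> Harm \<inter> A r"
        using deg[of a] deg[of b] deg[of c] deg[of e] w degs unfolding abce by auto
      have "integral (mhat [a, b, c, e] * w) =
          tree_form a b e w c - tree_form b c e w a + tree_form b c w a e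
          - tree_form c e w a b - tree_form a b c e w"
        using mem degs r by (intro integral_mhat_four) auto
      also have "\<dots> = 0" using mem xy r by (intro tree_form_cyclic_sum_zero[of r x y]) auto
      finally show ?thesis unfolding abce .
    qed
    then show "integral (pi_harm (mhat xs) * w) = 0"
      using integral_pi_harm_Harm[OF mA w] by simp
  qed
qed

lemma transferred_zero:
  assumes r: "2 \<le> r" "h_connected (r - 1)" "n \<le> 5 * r - 2" "h_dim (H r) \<le> 2"
    and Xs: "4 \<le> length Xs" "set Xs \<subseteq> Htot"
  shows "transferred Xs = cls 0"
proof -
  let ?xs = "map harm_rep Xs"
  have "pi_harm (mhat (map2 proj ps ?xs)) = 0" if "length ps = length ?xs" for ps
  proof (rule pi_harm_mhat_zero[OF r])
    fix x assume "x \<in> set (map2 proj ps ?xs)"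
    then obtain p X where "X \<in> set Xs" "x = proj p (harm_rep X)"
      by (auto dest!: set_zip_rightD)
    then show "x \<in> Harm \<and> (\<exists>k. x \<in> A k)"
      using Xs(2) harm_rep_in_Harm proj_Harm proj_in_A by blast
  qed (use that Xs in simp)
  then have "pi_harm (mhat_ext ?xs) = 0" unfolding mhat_ext_def ph.sum by simp
  then show ?thesis using Xs(1) by (simp add: transferred_def)
qed

end

theorem theorem6p1:
  fixes scale :: "rat \<Rightarrow> 'a::ring_1 \<Rightarrow> 'a"
    and n r :: nat
    and A :: "nat \<Rightarrow> 'a set"
    and d dm :: "'a \<Rightarrow> 'a"
    and integ :: "'a set \<Rightarrow> rat"
  assumes "pdgca scale n A d integ"
    and "r \<ge> 2"
    and "dgca.h_connected scale A d (r - 1)"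
    and "n \<le> 5 * r - 2"
    and "hodge_homotopy scale n A d integ dm"
    and "dgca.h_dim scale d (dgca.H A d r) \<le> 2"
  shows "\<forall>k\<ge>4. \<forall>Xs. length Xs = k \<and> set Xs \<subseteq> dgca.Htot d \<longrightarrow>
           hodge_homotopy.transferred n A d dm Xs = dgca.cls d 0"
  using hodge_homotopy.transferred_zero[OF assms(5,2,3,4,6)] by blast

end
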